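(* Let $\mathbb{K}\in\{\mathbb{R},\mathbb{C}\}$. The iterative enclosure method described in the context, applied to an interval generalized Sylvester matrix equation $\mathbf{A}X\mathbf{B}+\mathbf{C}X\mathbf{D}=\mathbf{F}$ with $\mathbf{A},\mathbf{C}\in\mathbb{IK}^{m\times m}$, $\mathbf{B},\mathbf{D}\in\mathbb{IK}^{n\times n}$, $\mathbf{F}\in\mathbb{IK}^{m\times n}$, requires $O(m^{3}+n^{3})$ arithmetic operations per iteration.
   Context: $\mathbb{IK}^{p\times q}$ is the set of $p\times q$ matrices whose entries are intervals $\langle x^{c},x^{\Delta}\rangle=\{x\in\mathbb{K}:|x-x^{c}|\le x^{\Delta}\}$. For an interval matrix $\mathbf{M}$, $M^{c}$ and $M^{\Delta}$ are its midpoint and radius matrices and $\operatorname{mag}(\mathbf{M})=|\mathbf{M}|=|M^{c}|+M^{\Delta}$. $./$ is entrywise division. Basic operations on intervals (including intersection) cost a bounded number of arithmetic operations, and matrix products are computed by the standard formula. It is assumed that $A^{c}=UD_AU^{-1}$, $C^{c}=UD_CU^{-1}$, $B^{c}=VD_BV^{-1}$, $D^{c}=VD_DV^{-1}$ with $U\in\mathbb{K}^{m\times m}$, $V\in\mathbb{K}^{n\times n}$ invertible and $D_A,D_B,D_C,D_D$ diagonal. Method. Compute these spectral decompositions (by a standard routine whose cost is counted as cubic in the dimension). Compute $\mathbf{A}_p=U^{-1}\mathbf{A}U$, $\mathbf{B}_p=V^{-1}\mathbf{B}V$, $\mathbf{C}_p=U^{-1}\mathbf{C}U$, $\mathbf{D}_p=V^{-1}\mathbf{D}V$,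 $\mathbf{F}_p=U^{-1}\mathbf{F}V$ in interval arithmetic, with diagonal midpoints $A_p^{c}=\operatorname{Diag}(a)$, $B_p^{c}=\operatorname{Diag}(b)$, $C_p^{c}=\operatorname{Diag}(c)$, $D_p^{c}=\operatorname{Diag}(d)$. Given an initial enclosure $\mathbf{Y}^{(0)}\in\mathbb{IK}^{m\times n}$ of the solution set of $\mathbf{A}_pY\mathbf{B}_p+\mathbf{C}_pY\mathbf{D}_p=\mathbf{F}_p$, iterate for $k=0,1,\dots$ $$T^{(k)}=\operatorname{mag}(\mathbf{A}_p)|\mathbf{Y}^{(k)}|B_p^{\Delta}+A_p^{\Delta}|\mathbf{Y}^{(k)}B_p^{c}|+\operatorname{mag}(\mathbf{C}_p)|\mathbf{Y}^{(k)}|D_p^{\Delta}+C_p^{\Delta}|\mathbf{Y}^{(k)}D_p^{c}|+F_p^{\Delta},$$ $$\mathbf{Y}^{(k+1)}=\Big([F_p^{c}-T^{(k)},F_p^{c}+T^{(k)}]\,./\,(ab^{\top}+cd^{\top})\Big)\cap\mathbf{Y}^{(k)},$$ until the distance between two successive iterates is smaller than a given tolerance; with the final iterate $\mathbf{Z}$, the resulting enclosure is $U\mathbf{Z}V^{-1}$. *)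

theory Defs
  imports Complex_Main "HOL-Library.Monad_Syntax" "Jordan_Normal_Form.Matrix"
begin

section \<open>Counting arithmetic operations\<close>

text \<open>A computation is a value together with the number of arithmetic operations spent on it.
  Everything below is assembled from the primitives \<open>op1\<close> and \<open>op2\<close>, which charge one unit for one
  operation on scalars (sum, difference, product, quotient, absolute value, maximum, comparison);
  only interval intersection and the spectral decomposition enter as black boxes.  Reading, storing and copying entries
  is free.\<close>

datatype 'b counted = Counted (val: 'b) (ops: nat)

definition ret :: "'b \<Rightarrow> 'b counted" where
  "ret x = Counted x 0"

definition bind_counted :: "'b counted \<Rightarrow> ('b \<Rightarrow> 'c counted) \<Rightarrow> 'c counted" where
  "bind_counted p f = Counted (val (f (val p))) (ops p + ops (f (val p)))"

adhoc_overloading Monad_Syntax.bind \<rightleftharpoons> bind_counted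

definition op1 :: "('b \<Rightarrow> 'c) \<Rightarrow> 'b \<Rightarrow> 'c counted" where
  "op1 f x = Counted (f x) 1"

definition op2 :: "('b \<Rightarrow> 'c \<Rightarrow> 'd) \<Rightarrow> 'b \<Rightarrow> 'c \<Rightarrow> 'd counted" where
  "op2 f x y = Counted (f x y) 1"

text \<open>Computing all entries of an \<open>nr \<times> nc\<close> matrix one after the other.\<close>

definition tabulate :: "nat \<Rightarrow> nat \<Rightarrow> (nat \<Rightarrow> nat \<Rightarrow> 'b counted) \<Rightarrow> 'b mat counted" where
  "tabulate nr nc f =
     Counted (mat nr nc (\<lambda>(i, j). val (f i j))) (\<Sum>i<nr. \<Sum>j<nc. ops (f i j))"

primrec accumulate ::
    "('b \<Rightarrow> 'b \<Rightarrow> 'b counted) \<Rightarrow> 'b \<Rightarrow> (nat \<Rightarrow> 'b counted) \<Rightarrow> nat \<Rightarrow> 'b counted" where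
  "accumulate g z f 0 = ret z"
| "accumulate g z f (Suc l) = do { s \<leftarrow> accumulate g z f l; x \<leftarrow> f l; g s x }"

definition entrywise1 :: "('b \<Rightarrow> 'c counted) \<Rightarrow> 'b mat \<Rightarrow> 'c mat counted" where
  "entrywise1 f M = tabulate (dim_row M) (dim_col M) (\<lambda>i j. f (M $$ (i, j)))"

definition entrywise2 ::
    "('b \<Rightarrow> 'c \<Rightarrow> 'd counted) \<Rightarrow> 'b mat \<Rightarrow> 'c mat \<Rightarrow> 'd mat counted" where
  "entrywise2 f M N = tabulate (dim_row M) (dim_col M) (\<lambda>i j. f (M $$ (i, j)) (N $$ (i, j)))"

text \<open>The standard formula for a matrix product, for given scalar addition \<open>g\<close> with neutral
  element \<open>z\<close> and given scalar multiplication \<open>h\<close>.\<close>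

definition standard_product ::
    "('d \<Rightarrow> 'd \<Rightarrow> 'd counted) \<Rightarrow> 'd \<Rightarrow> ('b \<Rightarrow> 'c \<Rightarrow> 'd counted) \<Rightarrow> 'b mat \<Rightarrow> 'c mat \<Rightarrow> 'd mat counted"
  where
  "standard_product g z h M N = tabulate (dim_row M) (dim_col N)
     (\<lambda>i j. accumulate g z (\<lambda>l. h (M $$ (i, l)) (N $$ (l, j))) (dim_col M))"

abbreviation real_product :: "real mat \<Rightarrow> real mat \<Rightarrow> real mat counted" where
  "real_product \<equiv> standard_product (op2 (+)) 0 (op2 (*))"

abbreviation real_plus :: "real mat \<Rightarrow> real mat \<Rightarrow> real mat counted" where
  "real_plus \<equiv> entrywise2 (op2 (+))"


section \<open>Intervals and interval matrices\<close>

text \<open>The scalars are an arbitrary \<open>real_normed_field\<close>; both \<open>real\<close> and \<open>complex\<close> are instances (and,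
  by the Gelfand-Mazur theorem, the only ones up to isomorphism).  A negative radius is not
  excluded by the type: it represents the empty interval, which can only arise as an
  intersection.\<close>

datatype 'a ivl = Ivl (mid: 'a) (rad: real)

definition ivl_set :: "'a::real_normed_field ivl \<Rightarrow> 'a set" where
  "ivl_set x = {t. norm (t - mid x) \<le> rad x}"

abbreviation mid_mat :: "'a ivl mat \<Rightarrow> 'a mat" where
  "mid_mat \<equiv> map_mat mid"

abbreviation rad_mat :: "'a ivl mat \<Rightarrow> real mat" where
  "rad_mat \<equiv> map_mat rad"

definition ivl_mats :: "nat \<Rightarrow> nat \<Rightarrow> 'a ivl mat set" where
  "ivl_mats p q = {M \<in> carrier_mat p q. \<forall>i<p. \<forall>j<q. 0 \<le> rad (M $$ (i, j))}"

definition ivl_mat_set :: "'a::real_normed_field ivl mat \<Rightarrow> 'a mat set" where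
  "ivl_mat_set M = {X \<in> carrier_mat (dim_row M) (dim_col M).
     \<forall>i<dim_row M. \<forall>j<dim_col M. X $$ (i, j) \<in> ivl_set (M $$ (i, j))}"

definition ivl_add :: "'a::real_normed_field ivl \<Rightarrow> 'a ivl \<Rightarrow> 'a ivl counted" where
  "ivl_add x y = do { c \<leftarrow> op2 (+) (mid x) (mid y); r \<leftarrow> op2 (+) (rad x) (rad y); ret (Ivl c r) }"

definition ivl_scale :: "'a::real_normed_field \<Rightarrow> 'a ivl \<Rightarrow> 'a ivl counted" where
  "ivl_scale s x = do {
     c \<leftarrow> op2 (*) s (mid x); t \<leftarrow> op1 norm s; r \<leftarrow> op2 (*) t (rad x); ret (Ivl c r) }"

definition ivl_divide :: "'a::real_normed_field ivl \<Rightarrow> 'a \<Rightarrow> 'a ivl counted" where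
  "ivl_divide x s = do {
     c \<leftarrow> op2 (/) (mid x) s; t \<leftarrow> op1 norm s; r \<leftarrow> op2 (/) (rad x) t; ret (Ivl c r) }"

definition ivl_mag :: "'a::real_normed_field ivl \<Rightarrow> real counted" where
  "ivl_mag x = do { t \<leftarrow> op1 norm (mid x); op2 (+) t (rad x) }"

text \<open>Hausdorff distance of two intervals (discs).\<close>

definition ivl_dist :: "'a::real_normed_field ivl \<Rightarrow> 'a ivl \<Rightarrow> real counted" where
  "ivl_dist x y = do {
     u \<leftarrow> op2 (-) (mid x) (mid y); v \<leftarrow> op1 norm u;
     w \<leftarrow> op2 (-) (rad x) (rad y); z \<leftarrow> op1 abs w; op2 (+) v z }"

text \<open>The intersection of two real intervals is an interval, that of two complex discs in general
  is not and has to be enclosed in a disc again.  Any routine that encloses the intersection, is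
  exact whenever the intersection is an interval (hence always exact over the reals) and has a
  bounded operation count is admitted.\<close>

definition intersection_routine ::
    "nat \<Rightarrow> ('a::real_normed_field ivl \<Rightarrow> 'a ivl \<Rightarrow> 'a ivl counted) \<Rightarrow> bool" where
  "intersection_routine \<beta> isect \<longleftrightarrow> (\<forall>x y.
     ivl_set x \<inter> ivl_set y \<subseteq> ivl_set (val (isect x y)) \<and>
     ((\<exists>z. ivl_set z = ivl_set x \<inter> ivl_set y) \<longrightarrow>
        ivl_set (val (isect x y)) = ivl_set x \<inter> ivl_set y) \<and>
     ops (isect x y) \<le> \<beta>)"

abbreviation point_ivl_product ::
    "'a::real_normed_field mat \<Rightarrow> 'a ivl mat \<Rightarrow> 'a ivl mat counted" where
  "point_ivl_product \<equiv> standard_product ivl_add (Ivl 0 0) ivl_scale"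

abbreviation ivl_point_product ::
    "'a::real_normed_field ivl mat \<Rightarrow> 'a mat \<Rightarrow> 'a ivl mat counted" where
  "ivl_point_product \<equiv> standard_product ivl_add (Ivl 0 0) (\<lambda>x s. ivl_scale s x)"

definition ivl_sandwich ::
    "'a::real_normed_field mat \<Rightarrow> 'a ivl mat \<Rightarrow> 'a mat \<Rightarrow> 'a ivl mat counted" where
  "ivl_sandwich P M Q = do { N \<leftarrow> point_ivl_product P M; ivl_point_product N Q }"

definition ivl_mat_dist :: "'a::real_normed_field ivl mat \<Rightarrow> 'a ivl mat \<Rightarrow> real counted" where
  "ivl_mat_dist M N =
     accumulate (op2 max) 0 (\<lambda>i.
       accumulate (op2 max) 0 (\<lambda>j. ivl_dist (M $$ (i, j)) (N $$ (i, j))) (dim_col M)) (dim_row M)"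


section \<open>The interval generalized Sylvester equation and the enclosure method\<close>

datatype 'a sylv =
  Sylv (matA: "'a ivl mat") (matB: "'a ivl mat") (matC: "'a ivl mat") (matD: "'a ivl mat")
    (matF: "'a ivl mat")

definition sylv_solutions :: "'a::real_normed_field sylv \<Rightarrow> 'a mat set" where
  "sylv_solutions E = {X \<in> carrier_mat (dim_row (matF E)) (dim_col (matF E)).
     \<exists>A \<in> ivl_mat_set (matA E). \<exists>B \<in> ivl_mat_set (matB E). \<exists>C \<in> ivl_mat_set (matC E).
     \<exists>D \<in> ivl_mat_set (matD E). \<exists>F \<in> ivl_mat_set (matF E).
       A * X * B + C * X * D = F}"

definition spectral_decomposition ::
    "'a::real_normed_field mat \<Rightarrow> 'a mat \<Rightarrow> 'a mat \<times> 'a mat \<times> 'a mat \<times> 'a mat \<Rightarrow> bool" where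
  "spectral_decomposition M N = (\<lambda>(W, Winv, S, T).
     similar_mat_wit M S W Winv \<and> similar_mat_wit N T W Winv \<and> diagonal_mat S \<and> diagonal_mat T)"

definition sylv_problem :: "nat \<Rightarrow> nat \<Rightarrow> 'a::real_normed_field sylv \<Rightarrow> bool" where
  "sylv_problem m n E \<longleftrightarrow>
     matA E \<in> ivl_mats m m \<and> matC E \<in> ivl_mats m m \<and>
     matB E \<in> ivl_mats n n \<and> matD E \<in> ivl_mats n n \<and> matF E \<in> ivl_mats m n \<and>
     Ex (spectral_decomposition (mid_mat (matA E)) (mid_mat (matC E))) \<and>
     Ex (spectral_decomposition (mid_mat (matB E)) (mid_mat (matD E)))"

text \<open>The standard routine for the spectral decompositions (including the inverse of the
  eigenvector matrix) is a black box whose count is cubic in the dimension.\<close>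

definition spectral_routine ::
    "nat \<Rightarrow> ('a::real_normed_field mat \<Rightarrow> 'a mat \<Rightarrow> ('a mat \<times> 'a mat \<times> 'a mat \<times> 'a mat) counted) \<Rightarrow> bool"
  where
  "spectral_routine \<gamma> eig \<longleftrightarrow> (\<forall>p M N.
     M \<in> carrier_mat p p \<and> N \<in> carrier_mat p p \<and> Ex (spectral_decomposition M N) \<longrightarrow>
       spectral_decomposition M N (val (eig M N)) \<and> ops (eig M N) \<le> \<gamma> * p ^ 3)"

text \<open>The transformed problem, together with \<open>U\<close> and the inverse of \<open>V\<close>, which are needed to
  transform back.\<close>

definition preconditioning ::
    "('a::real_normed_field mat \<Rightarrow> 'a mat \<Rightarrow> ('a mat \<times> 'a mat \<times> 'a mat \<times> 'a mat) counted) \<Rightarrow>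
     'a sylv \<Rightarrow> ('a mat \<times> 'a mat \<times> 'a sylv) counted" where
  "preconditioning eig E = do {
     (U, Uinv, DA, DC) \<leftarrow> eig (mid_mat (matA E)) (mid_mat (matC E));
     (V, Vinv, DB, DD) \<leftarrow> eig (mid_mat (matB E)) (mid_mat (matD E));
     A \<leftarrow> ivl_sandwich Uinv (matA E) U;
     B \<leftarrow> ivl_sandwich Vinv (matB E) V;
     C \<leftarrow> ivl_sandwich Uinv (matC E) U;
     D \<leftarrow> ivl_sandwich Vinv (matD E) V;
     F \<leftarrow> ivl_sandwich Uinv (matF E) V;
     ret (U, Vinv, Sylv A B C D F) }"

definition transformed ::
    "('a::real_normed_field mat \<Rightarrow> 'a mat \<Rightarrow> ('a mat \<times> 'a mat \<times> 'a mat \<times> 'a mat) counted) \<Rightarrow>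
     'a sylv \<Rightarrow> 'a sylv" where
  "transformed eig E = snd (snd (val (preconditioning eig E)))"

text \<open>The matrix \<open>T\<close>, for the transformed problem \<open>E\<close>.\<close>

definition perturbation_bound :: "'a::real_normed_field sylv \<Rightarrow> 'a ivl mat \<Rightarrow> real mat counted" where
  "perturbation_bound E Y = do {
     absY \<leftarrow> entrywise1 ivl_mag Y;

     magA \<leftarrow> entrywise1 ivl_mag (matA E);
     P \<leftarrow> real_product magA absY;
     P1 \<leftarrow> real_product P (rad_mat (matB E));

     YB \<leftarrow> ivl_point_product Y (mid_mat (matB E));
     absYB \<leftarrow> entrywise1 ivl_mag YB;
     P2 \<leftarrow> real_product (rad_mat (matA E)) absYB;

     magC \<leftarrow> entrywise1 ivl_mag (matC E);
     Q \<leftarrow> real_product magC absY;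
     P3 \<leftarrow> real_product Q (rad_mat (matD E));

     YD \<leftarrow> ivl_point_product Y (mid_mat (matD E));
     absYD \<leftarrow> entrywise1 ivl_mag YD;
     P4 \<leftarrow> real_product (rad_mat (matC E)) absYD;

     S1 \<leftarrow> real_plus P1 P2;
     S2 \<leftarrow> real_plus S1 P3;
     S3 \<leftarrow> real_plus S2 P4;
     real_plus S3 (rad_mat (matF E)) }"

text \<open>The matrix \<open>a b\<^sup>T + c d\<^sup>T\<close>, with \<open>a, b, c, d\<close> the diagonals of the midpoint matrices.\<close>

definition denominators :: "nat \<Rightarrow> nat \<Rightarrow> 'a::real_normed_field sylv \<Rightarrow> 'a mat counted" where
  "denominators m n E = tabulate m n (\<lambda>i j. do {
     u \<leftarrow> op2 (*) (mid (matA E $$ (i, i))) (mid (matB E $$ (j, j)));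
     v \<leftarrow> op2 (*) (mid (matC E $$ (i, i))) (mid (matD E $$ (j, j)));
     op2 (+) u v })"

text \<open>One iteration for the transformed problem \<open>E\<close> from the iterate \<open>Y\<close>: the next iterate and the
  outcome of the stopping test.  The interval with end points \<open>F\<^sup>c - T\<close> and \<open>F\<^sup>c + T\<close> has midpoint
  \<open>F\<^sup>c\<close> and radius \<open>T\<close>.\<close>

definition iteration ::
    "('a::real_normed_field ivl \<Rightarrow> 'a ivl \<Rightarrow> 'a ivl counted) \<Rightarrow> real \<Rightarrow> 'a sylv \<Rightarrow> 'a ivl mat \<Rightarrow>
     ('a ivl mat \<times> bool) counted" where
  "iteration isect tol E Y = do {
     T \<leftarrow> perturbation_bound E Y;
     N \<leftarrow> entrywise2 (\<lambda>f t. ret (Ivl f t)) (mid_mat (matF E)) T;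
     \<Delta> \<leftarrow> denominators (dim_row Y) (dim_col Y) E;
     Q \<leftarrow> entrywise2 ivl_divide N \<Delta>;
     Y' \<leftarrow> entrywise2 isect Q Y;
     \<delta> \<leftarrow> ivl_mat_dist Y' Y;
     stop \<leftarrow> op2 (<) \<delta> tol;
     ret (Y', stop) }"

text \<open>The sequence of iterates, regardless of the stopping test.\<close>

definition iterate ::
    "('a::real_normed_field ivl \<Rightarrow> 'a ivl \<Rightarrow> 'a ivl counted) \<Rightarrow> real \<Rightarrow> 'a sylv \<Rightarrow> 'a ivl mat \<Rightarrow>
     nat \<Rightarrow> 'a ivl mat" where
  "iterate isect tol E Y0 k = ((\<lambda>Y. fst (val (iteration isect tol E Y))) ^^ k) Y0"

text \<open>\<open>loop isect tol E Y N Z t\<close>: started from \<open>Y\<close>, the loop stops after \<open>N\<close> iterations with final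
  iterate \<open>Z\<close>, having spent \<open>t\<close> operations.\<close>

inductive loop ::
    "('a::real_normed_field ivl \<Rightarrow> 'a ivl \<Rightarrow> 'a ivl counted) \<Rightarrow> real \<Rightarrow> 'a sylv \<Rightarrow> 'a ivl mat \<Rightarrow>
     nat \<Rightarrow> 'a ivl mat \<Rightarrow> nat \<Rightarrow> bool"
  for isect tol E where
  stop: "iteration isect tol E Y = Counted (Y', True) t \<Longrightarrow> loop isect tol E Y 1 Y' t"
| continue: "iteration isect tol E Y = Counted (Y', False) t \<Longrightarrow> loop isect tol E Y' N Z s \<Longrightarrow>
    loop isect tol E Y (Suc N) Z (t + s)"

text \<open>A complete run of the method: \<open>N\<close> is the number of iterations, \<open>X\<close> the resulting enclosure and
  \<open>t\<close> the total number of operations.\<close>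

definition method_run ::
    "('a::real_normed_field ivl \<Rightarrow> 'a ivl \<Rightarrow> 'a ivl counted) \<Rightarrow>
     ('a mat \<Rightarrow> 'a mat \<Rightarrow> ('a mat \<times> 'a mat \<times> 'a mat \<times> 'a mat) counted) \<Rightarrow> real \<Rightarrow>
     'a sylv \<Rightarrow> 'a ivl mat \<Rightarrow> nat \<Rightarrow> 'a ivl mat \<Rightarrow> nat \<Rightarrow> bool" where
  "method_run isect eig tol E Y0 N X t \<longleftrightarrow>
     (\<exists>U Vinv Ep s Z r q.
        preconditioning eig E = Counted (U, Vinv, Ep) s \<and>
        loop isect tol Ep Y0 N Z r \<and>
        ivl_sandwich U Z Vinv = Counted X q \<and>
        t = s + r + q)"

definition initial_enclosure :: "nat \<Rightarrow> nat \<Rightarrow> 'a::real_normed_field sylv \<Rightarrow> 'a ivl mat \<Rightarrow> bool" where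
  "initial_enclosure m n E Y0 \<longleftrightarrow> Y0 \<in> ivl_mats m n \<and> sylv_solutions E \<subseteq> ivl_mat_set Y0"

end

theory Submission
  imports Defs
begin

text \<open>Apart from the spectral decompositions, whose cost is cubic by assumption, the method consists of
  matrix products by the standard formula, which spend a constant number of operations on each of
  their \<open>p q r\<close> scalar terms, and of entrywise operations and a maximum over all entries, whose cost per
  entry is bounded by a constant (\<open>\<beta>\<close> in the case of the intersection). All
  dimensions that occur are \<open>m\<close> or \<open>n\<close>, and any product of three numbers from \<open>{m, n}\<close> is at most \<open>m\<^sup>3 + n\<^sup>3\<close> (\<open>triple_product_le\<close>); products with fewer factors are
  smaller still because \<open>m, n \<ge> 1\<close>. Adding up the constants gives
  \<open>ops_iteration_le\<close> for one iteration, \<open>preconditioning_cost\<close> for the set-up and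
  \<open>back_transformation_cost\<close> for the return to the original coordinates.

  The crucial point is the order of evaluation: in \<open>T\<close> there are triple products such as
  \<open>mag(A) |Y| B\<^sup>\<Delta>\<close>, but each is computed as two successive matrix products, so that no term of
  degree four in the dimensions arises. That every iterate keeps the dimensions \<open>m \<times> n\<close> makes the
  bound uniform in the iteration index. Since a complete run has at least one iteration, the set-up and
  the back transformation are absorbed in the bound for the whole run.\<close>

section \<open>Operation counts of the building blocks\<close>

lemma val_ret [simp]: "val (ret x) = x" and ops_ret [simp]: "ops (ret x) = 0"
  by (simp_all add: ret_def)

lemma val_bind_counted [simp]: "val (bind_counted p f) = val (f (val p))"
  and ops_bind_counted [simp]: "ops (bind_counted p f) = ops p + ops (f (val p))"
  by (simp_all add: bind_counted_def)

lemma ops_op1 [simp]: "ops (op1 f x) = 1" and ops_op2 [simp]: "ops (op2 g x y) = 1"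
  by (simp_all add: op1_def op2_def)

lemma ops_ivl_add [simp]: "ops (ivl_add x y) = 2"
  and ops_ivl_scale [simp]: "ops (ivl_scale s x) = 3"
  and ops_ivl_divide [simp]: "ops (ivl_divide x s) = 3"
  and ops_ivl_mag [simp]: "ops (ivl_mag x) = 2"
  and ops_ivl_dist [simp]: "ops (ivl_dist x y) = 5"
  by (simp_all add: ivl_add_def ivl_scale_def ivl_divide_def ivl_mag_def ivl_dist_def)

lemma dim_tabulate [simp]:
  "dim_row (val (tabulate nr nc f)) = nr" "dim_col (val (tabulate nr nc f)) = nc"
  by (simp_all add: tabulate_def)

lemma ops_tabulate_const: "(\<And>i j. ops (f i j) = c) \<Longrightarrow> ops (tabulate nr nc f) = nr * nc * c"
  by (simp add: tabulate_def)

lemma ops_tabulate_le: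
  assumes "\<And>i j. ops (f i j) \<le> c"
  shows "ops (tabulate nr nc f) \<le> nr * nc * c"
proof -
  have "(\<Sum>i<nr. \<Sum>j<nc. ops (f i j)) \<le> (\<Sum>i<nr. \<Sum>j<nc. c)"
    by (intro sum_mono assms)
  then show ?thesis by (simp add: tabulate_def)
qed

lemma ops_accumulate_const:
  assumes "\<And>x y. ops (g x y) = a" and "\<And>l. ops (f l) = b"
  shows "ops (accumulate g z f l) = l * (a + b)"
  by (induction l) (simp_all add: assms)

lemma dim_standard_product [simp]:
  "dim_row (val (standard_product g z h M N)) = dim_row M"
  "dim_col (val (standard_product g z h M N)) = dim_col N"
  by (simp_all add: standard_product_def)

lemma ops_standard_product_const:
  assumes "\<And>x y. ops (g x y) = a" and "\<And>x y. ops (h x y) = b"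
  shows "ops (standard_product g z h M N) = dim_row M * dim_col N * (dim_col M * (a + b))"
  unfolding standard_product_def
  by (intro ops_tabulate_const ops_accumulate_const assms)

lemma ops_real_product [simp]:
  "ops (real_product M N) = dim_row M * dim_col N * (dim_col M * 2)"
  by (subst ops_standard_product_const [where a = 1 and b = 1]) simp_all

lemma ops_point_ivl_product [simp]:
  "ops (point_ivl_product P M) = dim_row P * dim_col M * (dim_col P * 5)"
  by (subst ops_standard_product_const [where a = 2 and b = 3]) simp_all

lemma ops_ivl_point_product [simp]:
  "ops (ivl_point_product M Q) = dim_row M * dim_col Q * (dim_col M * 5)"
  by (subst ops_standard_product_const [where a = 2 and b = 3]) simp_all

lemma dim_ivl_sandwich [simp]:
  "dim_row (val (ivl_sandwich P M Q)) = dim_row P"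
  "dim_col (val (ivl_sandwich P M Q)) = dim_col Q"
  by (simp_all add: ivl_sandwich_def)

lemma ops_ivl_sandwich:
  "ops (ivl_sandwich P M Q) =
     5 * (dim_row P * dim_col M * dim_col P) + 5 * (dim_row P * dim_col Q * dim_col M)"
  by (simp add: ivl_sandwich_def)

lemma dim_entrywise [simp]:
  "dim_row (val (entrywise1 f M)) = dim_row M"
  "dim_col (val (entrywise1 f M)) = dim_col M"
  "dim_row (val (entrywise2 g M N)) = dim_row M"
  "dim_col (val (entrywise2 g M N)) = dim_col M"
  by (simp_all add: entrywise1_def entrywise2_def)

lemma ops_entrywise1_const:
  "(\<And>x. ops (f x) = c) \<Longrightarrow> ops (entrywise1 f M) = dim_row M * dim_col M * c"
  unfolding entrywise1_def by (rule ops_tabulate_const)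

lemma ops_entrywise2_const:
  "(\<And>x y. ops (f x y) = c) \<Longrightarrow> ops (entrywise2 f M N) = dim_row M * dim_col M * c"
  unfolding entrywise2_def by (rule ops_tabulate_const)

lemma ops_entrywise2_le:
  "(\<And>x y. ops (f x y) \<le> c) \<Longrightarrow> ops (entrywise2 f M N) \<le> dim_row M * dim_col M * c"
  unfolding entrywise2_def by (rule ops_tabulate_le)

lemma ops_ivl_mat_dist: "ops (ivl_mat_dist M N) = dim_row M * (1 + dim_col M * 6)"
proof -
  have inner: "ops (accumulate (op2 max) (0::real) (\<lambda>j. ivl_dist (M $$ (i, j)) (N $$ (i, j)))
      (dim_col M)) = dim_col M * 6" for i
    by (subst ops_accumulate_const [where a = 1 and b = 5]) simp_all
  show ?thesis
    unfolding ivl_mat_dist_def by (intro ops_accumulate_const inner) simp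
qed

lemma ops_denominators: "ops (denominators m n E) = m * n * 3"
  unfolding denominators_def by (rule ops_tabulate_const) simp


section \<open>One iteration\<close>

text \<open>The larger of the two dimensions bounds each factor, and its cube is one of the two
  summands.\<close>

lemma triple_product_le:
  fixes m n :: nat
  assumes "a \<in> {m, n}" "b \<in> {m, n}" "c \<in> {m, n}"
  shows "a * b * c \<le> m ^ 3 + n ^ 3"
proof -
  define p where "p = max m n"
  have "a \<le> p" "b \<le> p" "c \<le> p" using assms by (auto simp: p_def)
  then have "a * b * c \<le> p * p * p" by (intro mult_le_mono)
  also have "\<dots> = p ^ 3" by (simp add: power3_eq_cube)
  also have "\<dots> \<le> m ^ 3 + n ^ 3" by (simp add: p_def max_def)
  finally show ?thesis .
qed

lemma monomials_le:
  fixes m n :: nat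
  assumes "1 \<le> m" "1 \<le> n"
  shows "m * m * n \<le> m ^ 3 + n ^ 3" "m * n * n \<le> m ^ 3 + n ^ 3"
    "m * m \<le> m ^ 3 + n ^ 3" "m * n \<le> m ^ 3 + n ^ 3" "m \<le> m ^ 3 + n ^ 3" "1 \<le> m ^ 3 + n ^ 3"
proof -
  show mmn: "m * m * n \<le> m ^ 3 + n ^ 3" and "m * n * n \<le> m ^ 3 + n ^ 3"
    by (rule triple_product_le; simp)+
  have "m * m * 1 \<le> m * m * n" "m * 1 * n \<le> m * m * n" "m * 1 * 1 \<le> m * m * n" "1 * 1 * 1 \<le> m * m * n"
    using assms by (intro mult_le_mono; simp)+
  then show "m * m \<le> m ^ 3 + n ^ 3" "m * n \<le> m ^ 3 + n ^ 3" "m \<le> m ^ 3 + n ^ 3" "1 \<le> m ^ 3 + n ^ 3"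
    using mmn by linarith+
qed

definition sylv_dims :: "nat \<Rightarrow> nat \<Rightarrow> 'a sylv \<Rightarrow> bool" where
  "sylv_dims m n E \<longleftrightarrow>
     matA E \<in> carrier_mat m m \<and> matC E \<in> carrier_mat m m \<and>
     matB E \<in> carrier_mat n n \<and> matD E \<in> carrier_mat n n \<and> matF E \<in> carrier_mat m n"

text \<open>The coefficient of \<open>m n\<close> collects three magnitude matrices and four additions, that of
  \<open>m\<^sup>2\<close> the magnitudes of \<open>A\<close> and \<open>C\<close>; the cubic terms are the real products (two operations per
  scalar term) and the interval products with midpoints (five operations per scalar term).\<close>

lemma ops_perturbation_bound:
  assumes "sylv_dims m n E" "Y \<in> carrier_mat m n"
  shows "ops (perturbation_bound E Y) =
    8 * (m * m * n) + 14 * (m * n * n) + 4 * (m * m) + 10 * (m * n)"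
  using assms
  by (auto simp: sylv_dims_def perturbation_bound_def ops_entrywise1_const [where c = 2]
      ops_entrywise2_const [where c = 1] algebra_simps)

text \<open>The next iterate takes its dimensions from the right-hand side \<open>F\<close>.\<close>

lemma iteration_carrier:
  assumes "sylv_dims m n E"
  shows "fst (val (iteration isect tol E Y)) \<in> carrier_mat m n"
  using assms by (intro carrier_matI) (auto simp: sylv_dims_def iteration_def)

lemma iterate_carrier:
  assumes "sylv_dims m n E" "Y0 \<in> carrier_mat m n"
  shows "iterate isect tol E Y0 k \<in> carrier_mat m n"
  by (cases k) (simp_all add: iterate_def assms iteration_carrier)

lemma ops_iteration_le:
  assumes dims: "sylv_dims m n E" "Y \<in> carrier_mat m n"
    and isect: "\<And>x y. ops (isect x y) \<le> \<beta>"
    and pos: "1 \<le> m" "1 \<le> n"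
  shows "ops (iteration isect tol E Y) \<le> (50 + \<beta>) * (m ^ 3 + n ^ 3)"
proof -
  have F: "dim_row (matF E) = m" "dim_col (matF E) = n" and Y: "dim_row Y = m" "dim_col Y = n"
    using dims by (auto simp: sylv_dims_def)
  define N where "N = val (entrywise2 (\<lambda>f t. ret (Ivl f t)) (mid_mat (matF E))
    (val (perturbation_bound E Y)))"
  define Q where "Q = val (entrywise2 ivl_divide N (val (denominators m n E)))"
  define Y' where "Y' = val (entrywise2 isect Q Y)"
  have "ops (entrywise2 isect Q Y) \<le> m * n * \<beta>"
    using ops_entrywise2_le [where M = Q and N = Y, OF isect] by (simp add: Q_def N_def F)
  moreover have "m * n * \<beta> \<le> (m ^ 3 + n ^ 3) * \<beta>"
    using monomials_le(4) [OF pos] by (rule mult_le_mono1)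
  moreover have "ops (iteration isect tol E Y) =
      ops (perturbation_bound E Y) + m * n * 3 + m * n * 3 + ops (entrywise2 isect Q Y)
        + m * (1 + n * 6) + 1"
    by (simp add: iteration_def F Y ops_entrywise2_const [where c = 0]
        ops_entrywise2_const [where c = 3] ops_denominators ops_ivl_mat_dist
        Y'_def [symmetric] Q_def N_def)
  ultimately show ?thesis
    using monomials_le [OF pos] ops_perturbation_bound [OF dims] by (simp add: algebra_simps)
qed

text \<open>That at least one iteration takes place is part of the claim because it allows costs incurred
  once per run to be charged to the iterations; the dimensions of \<open>Z\<close> enter the cost of
  transforming it back.\<close>

lemma loop_cost:
  assumes "loop isect tol E Y N Z t"
    and "sylv_dims m n E" "Y \<in> carrier_mat m n"
    and "\<And>Y. Y \<in> carrier_mat m n \<Longrightarrow> ops (iteration isect tol E Y) \<le> c"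
  shows "1 \<le> N \<and> Z \<in> carrier_mat m n \<and> t \<le> c * N"
  using assms
proof (induction rule: loop.induct)
  case (stop Y Y' t)
  then show ?case
    using iteration_carrier [OF stop.prems(1), of isect tol Y] stop.prems(3) [OF stop.prems(2)]
    by simp
next
  case (continue Y Y' t N Z s)
  have "Y' \<in> carrier_mat m n"
    using iteration_carrier [OF continue.prems(1), of isect tol Y] continue.hyps(1) by simp
  then have "1 \<le> N \<and> Z \<in> carrier_mat m n \<and> s \<le> c * N"
    using continue.IH continue.prems(1,3) by blast
  moreover have "t \<le> c"
    using continue.prems(3) [OF continue.prems(2)] continue.hyps(1) by simp
  ultimately show ?case by simp
qed


section \<open>Set-up and complete runs\<close>

lemma spectral_decomposition_carrier:
  assumes "spectral_decomposition M N (W, Winv, S, T)" "M \<in> carrier_mat p p"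
  shows "W \<in> carrier_mat p p" "Winv \<in> carrier_mat p p"
  using assms by (auto simp: spectral_decomposition_def similar_mat_wit_def Let_def)

text \<open>The two decompositions contribute \<open>\<gamma> (m\<^sup>3 + n\<^sup>3)\<close>, each of the five two-sided products at most
  \<open>10 (m\<^sup>3 + n\<^sup>3)\<close>. The dimensions of the results are recorded because the counts for the iteration and for the
  back transformation are stated in terms of them.\<close>

lemma preconditioning_cost:
  assumes eig: "spectral_routine \<gamma> eig" and E: "sylv_problem m n E"
    and pre: "preconditioning eig E = Counted (U, Vinv, Ep) s"
  shows "sylv_dims m n Ep" "U \<in> carrier_mat m m" "Vinv \<in> carrier_mat n n"
    "s \<le> (50 + \<gamma>) * (m ^ 3 + n ^ 3)"
proof -
  have car: "matA E \<in> carrier_mat m m" "matC E \<in> carrier_mat m m"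
    "matB E \<in> carrier_mat n n" "matD E \<in> carrier_mat n n" "matF E \<in> carrier_mat m n"
    using E by (auto simp: sylv_problem_def ivl_mats_def)
  obtain W Winv DA DC where W: "val (eig (mid_mat (matA E)) (mid_mat (matC E))) = (W, Winv, DA, DC)"
    by (cases "val (eig (mid_mat (matA E)) (mid_mat (matC E)))")
  obtain V V' DB DD where V: "val (eig (mid_mat (matB E)) (mid_mat (matD E))) = (V, V', DB, DD)"
    by (cases "val (eig (mid_mat (matB E)) (mid_mat (matD E)))")
  have decW: "spectral_decomposition (mid_mat (matA E)) (mid_mat (matC E)) (W, Winv, DA, DC)"
    and opsW: "ops (eig (mid_mat (matA E)) (mid_mat (matC E))) \<le> \<gamma> * m ^ 3"
    using eig E car unfolding spectral_routine_def sylv_problem_def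
    by (metis W map_carrier_mat)+
  have decV: "spectral_decomposition (mid_mat (matB E)) (mid_mat (matD E)) (V, V', DB, DD)"
    and opsV: "ops (eig (mid_mat (matB E)) (mid_mat (matD E))) \<le> \<gamma> * n ^ 3"
    using eig E car unfolding spectral_routine_def sylv_problem_def
    by (metis V map_carrier_mat)+
  have Wc: "W \<in> carrier_mat m m" "Winv \<in> carrier_mat m m"
    using spectral_decomposition_carrier [OF decW] car by auto
  have Vc: "V \<in> carrier_mat n n" "V' \<in> carrier_mat n n"
    using spectral_decomposition_carrier [OF decV] car by auto
  have result: "(U, Vinv, Ep) = (W, V', Sylv
      (val (ivl_sandwich Winv (matA E) W)) (val (ivl_sandwich V' (matB E) V))
      (val (ivl_sandwich Winv (matC E) W)) (val (ivl_sandwich V' (matD E) V))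
      (val (ivl_sandwich Winv (matF E) V)))"
    using arg_cong [OF pre, of val] by (auto simp: preconditioning_def W V)
  show "U \<in> carrier_mat m m" "Vinv \<in> carrier_mat n n" using result Wc Vc by auto
  show "sylv_dims m n Ep"
    using result Wc Vc by (auto simp: sylv_dims_def)
  have "s = ops (eig (mid_mat (matA E)) (mid_mat (matC E)))
      + ops (eig (mid_mat (matB E)) (mid_mat (matD E)))
      + ops (ivl_sandwich Winv (matA E) W) + ops (ivl_sandwich V' (matB E) V)
      + ops (ivl_sandwich Winv (matC E) W) + ops (ivl_sandwich V' (matD E) V)
      + ops (ivl_sandwich Winv (matF E) V)"
    using arg_cong [OF pre, of ops] by (simp add: preconditioning_def W V)
  also have "\<dots> \<le> \<gamma> * m ^ 3 + \<gamma> * n ^ 3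
      + 10 * (m * m * m) + 10 * (n * n * n) + 10 * (m * m * m) + 10 * (n * n * n)
      + (5 * (m * n * m) + 5 * (m * n * n))"
    using opsW opsV car Wc Vc by (simp add: ops_ivl_sandwich)
  also have "\<dots> \<le> (50 + \<gamma>) * (m ^ 3 + n ^ 3)"
    using triple_product_le [of m m n n m] triple_product_le [of m m n n n]
    by (simp add: algebra_simps power3_eq_cube)
  finally show "s \<le> (50 + \<gamma>) * (m ^ 3 + n ^ 3)" .
qed

lemma back_transformation_cost:
  assumes "U \<in> carrier_mat m m" "Z \<in> carrier_mat m n" "W \<in> carrier_mat n n"
  shows "ops (ivl_sandwich U Z W) \<le> 10 * (m ^ 3 + n ^ 3)"
  using assms triple_product_le [of m m n n m] triple_product_le [of m m n n n]
  by (simp add: ops_ivl_sandwich)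

theorem theorem2p7:
  fixes \<beta> \<gamma> :: nat
  shows "\<exists>K::nat.
    \<forall>(isect :: 'a::real_normed_field ivl \<Rightarrow> 'a ivl \<Rightarrow> 'a ivl counted)
     (eig :: 'a mat \<Rightarrow> 'a mat \<Rightarrow> ('a mat \<times> 'a mat \<times> 'a mat \<times> 'a mat) counted)
     (tol :: real) (m :: nat) (n :: nat) (E :: 'a sylv) (Y0 :: 'a ivl mat).
      intersection_routine \<beta> isect \<longrightarrow> spectral_routine \<gamma> eig \<longrightarrow> 0 < tol \<longrightarrow>
      1 \<le> m \<longrightarrow> 1 \<le> n \<longrightarrow> sylv_problem m n E \<longrightarrow>
      initial_enclosure m n (transformed eig E) Y0 \<longrightarrow>
        ops (preconditioning eig E) \<le> K * (m ^ 3 + n ^ 3) \<and>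
        (\<forall>k. ops (iteration isect tol (transformed eig E)
                   (iterate isect tol (transformed eig E) Y0 k)) \<le> K * (m ^ 3 + n ^ 3)) \<and>
        (\<forall>N X t. method_run isect eig tol E Y0 N X t \<longrightarrow> t \<le> K * (m ^ 3 + n ^ 3) * N)"
  \<comment> \<open>The constant is \<open>(50 + \<beta>) + (50 + \<gamma>) + 10\<close>: one iteration, the set-up and the back transformation.\<close>
proof (intro exI [of _ "110 + \<beta> + \<gamma>"] allI impI)
  fix isect :: "'a ivl \<Rightarrow> 'a ivl \<Rightarrow> 'a ivl counted"
    and eig :: "'a mat \<Rightarrow> 'a mat \<Rightarrow> ('a mat \<times> 'a mat \<times> 'a mat \<times> 'a mat) counted"
    and tol :: real and m n :: nat and E :: "'a sylv" and Y0 :: "'a ivl mat"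
  assume isect: "intersection_routine \<beta> isect" and eig: "spectral_routine \<gamma> eig"
    and pos: "1 \<le> m" "1 \<le> n" and E: "sylv_problem m n E"
    and Y0: "initial_enclosure m n (transformed eig E) Y0"
  define S where "S = m ^ 3 + n ^ 3"
  obtain U Vinv Ep s where pre: "preconditioning eig E = Counted (U, Vinv, Ep) s"
    by (metis counted.exhaust prod.exhaust)
  have Ep: "transformed eig E = Ep" by (simp add: transformed_def pre)
  note setup_cost = preconditioning_cost [OF eig E pre, folded S_def]
  have Y0c: "Y0 \<in> carrier_mat m n" using Y0 by (simp add: initial_enclosure_def ivl_mats_def)
  have isect_ops: "ops (isect x y) \<le> \<beta>" for x y
    using isect by (simp add: intersection_routine_def)
  have step: "ops (iteration isect tol Ep Y) \<le> (50 + \<beta>) * S" if "Y \<in> carrier_mat m n" for Y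
    unfolding S_def using ops_iteration_le [OF setup_cost(1) that isect_ops pos] .
  have run: "t \<le> (110 + \<beta> + \<gamma>) * S * N" if "method_run isect eig tol E Y0 N X t" for N X t
  proof -
    from that obtain Z r q where loop: "loop isect tol Ep Y0 N Z r"
      and res: "ivl_sandwich U Z Vinv = Counted X q" and t: "t = s + r + q"
      by (auto simp: method_run_def pre)
    have N: "1 \<le> N" and Z: "Z \<in> carrier_mat m n" and r: "r \<le> (50 + \<beta>) * S * N"
      using loop_cost [OF loop setup_cost(1) Y0c step] by blast+
    have q: "q \<le> 10 * S"
      using back_transformation_cost [OF setup_cost(2) Z setup_cost(3)] res by (simp add: S_def)
    have "t \<le> (60 + \<gamma>) * S * 1 + (50 + \<beta>) * S * N"
      using setup_cost(4) r q by (simp add: t algebra_simps)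
    also have "\<dots> \<le> (60 + \<gamma>) * S * N + (50 + \<beta>) * S * N"
      using N by (intro add_right_mono mult_le_mono2)
    also have "\<dots> = (110 + \<beta> + \<gamma>) * S * N" by (simp add: algebra_simps)
    finally show ?thesis .
  qed
  have "ops (preconditioning eig E) \<le> (110 + \<beta> + \<gamma>) * S"
    using setup_cost(4) by (simp add: pre algebra_simps)
  moreover have "ops (iteration isect tol Ep (iterate isect tol Ep Y0 k)) \<le> (110 + \<beta> + \<gamma>) * S" for k
    using step [OF iterate_carrier [OF setup_cost(1) Y0c]]
    by (rule order_trans) (simp add: algebra_simps)
  ultimately show "ops (preconditioning eig E) \<le> (110 + \<beta> + \<gamma>) * (m ^ 3 + n ^ 3) \<and>
      (\<forall>k. ops (iteration isect tol (transformed eig E)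
         (iterate isect tol (transformed eig E) Y0 k)) \<le> (110 + \<beta> + \<gamma>) * (m ^ 3 + n ^ 3)) \<and>
      (\<forall>N X t. method_run isect eig tol E Y0 N X t \<longrightarrow>
         t \<le> (110 + \<beta> + \<gamma>) * (m ^ 3 + n ^ 3) * N)"
    using run unfolding S_def Ep by blast
qed

end
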